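(* $P \approx Q \implies P \equiv Q$, i.e., if $P$ and $Q$ are weakly bisimilar then they are weakly logically equivalent.
   Context: Setting: a nominal transition system. It consists of a nominal set of states $P,Q,\ldots$; a nominal set of state predicates $\varphi$; an equivariant relation $P \vdash \varphi$ ("$\varphi$ holds in state $P$"); a nominal set of actions $\alpha$ with an equivariant function $\operatorname{bn}$ giving each action a finite set of binding names $\operatorname{bn}(\alpha)\subseteq\operatorname{supp}(\alpha)$; and an equivariant transition relation $P \xrightarrow{\alpha} P'$, where the names in $\operatorname{bn}(\alpha)$ bind into $P'$ (transitions are closed under alpha-conversion of binding names). There is a special silent action $\tau$ with empty support. We write $a \# X$ for "$a$ is not in the support of $X$". Weak transitions: $P \Rightarrow P'$ is defined inductively to mean $P=P'$ or $P \xrightarrow{\tau} P'' \Rightarrow P'$ for some $P''$; $P \stackrel{\alpha}{\Longrightarrow} P'$ means $P \Rightarrow\circ\xrightarrow{\alpha}\circ\Rightarrow P'$; and $P \stackrel{\hat\alpha}{\Longrightarrow} P'$ means $P \Rightarrow P'$ if $\alpha=\tau$ and $P \stackrel{\alpha}{\Longrightarrow} P'$ otherwise. A binary relation $R$ on states is a weak simulation if $R(P,Q)$ implies that for all $\alpha,P'$ with $\operatorname{bn}(\alpha)\# Q$, if $P\xrightarrow{\alpha}P'$ then there is $Q'$ with $Q \stackrel{\hat\alpha}{\Longrightarrow} Q'$ and $R(P',Q')$. It is a weak static implication if $R(P,Q)$ implies that for all $\varphi$, if $P\vdash\varphi$ then there is $Q'$ with $Q\Rightarrow Q'$, $Q'\vdash\varphi$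 and $R(P,Q')$. A weak bisimulation is a symmetric relation satisfying both; $P \approx Q$ (weak bisimilarity) means some weak bisimulation relates $P$ and $Q$. Formulas: fix an infinite cardinal $\kappa$ with $\kappa>\aleph_0$ and $\kappa>|\text{states}|$. Formulas are $A ::= \bigwedge_{i\in I}A_i \mid \neg A \mid \varphi \mid \langle\alpha\rangle A$, where the conjunct set $\{A_i\mid i\in I\}$ must have cardinality $<\kappa$ and finite support, and in $\langle\alpha\rangle A$ the names $\operatorname{bn}(\alpha)$ are bound in $\alpha$ and $A$. Satisfaction: $P\models\bigwedge_{i\in I}A_i$ iff $P\models A_i$ for all $i$; $P\models\neg A$ iff not $P\models A$; $P\models\varphi$ iff $P\vdash\varphi$; $P\models\langle\alpha\rangle A$ iff (for an alpha-variant with $\operatorname{bn}(\alpha)\# P$) there is $P'$ with $P\xrightarrow{\alpha}P'$ and $P'\models A$. Disjunction $\bigvee_{i\in I}A_i$ abbreviates $\neg\bigwedge_{i\in I}\neg A_i$. Weak modalities: $\langle\langle\tau\rangle\rangle A=\bigvee_{i\in\omega}\langle\tau\rangle^iA$ (where $\langle\tau\rangle^0A=A$ and $\langle\tau\rangle^{i}A=\langle\tau\rangle\langle\tau\rangle^{i-1}A$), and $\langle\langle\alpha\rangle\rangle A=\langle\langle\tau\rangle\rangle\langle\alpha\rangle\langle\langle\tau\rangle\rangle A$ for $\alpha\ne\tau$. Weak formulas are the sublogic $A ::= \bigwedge_{i\in I}A_i \mid \neg A \mid \langle\langle\alpha\rangle\rangle A \mid \langle\langle\tau\rangle\rangle(A\wedge\varphi)$.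 Two states are weakly logically equivalent, $P\equiv Q$, if for all weak formulas $A$: $P\models A$ iff $Q\models A$. *)

theory Defs
  imports "HOL-Combinatorics.Perm"
begin

unbundle cardinal_syntax and permutation_syntax

datatype name = Name nat

lemma infinite_names: "infinite (UNIV :: name set)"
proof -
  have "inj Name" by (simp add: inj_def)
  then show ?thesis
    using infinite_UNIV_nat finite_imageD finite_subset subset_UNIV by metis
qed

text \<open>
  Sets with an action of the group of finite permutations of names; elements of
  \<open>pt\<close> types need not be finitely supported, types of class \<open>fs\<close> are nominal sets.
\<close>

class pt =
  fixes permute :: "name perm \<Rightarrow> 'a \<Rightarrow> 'a"  (infixr \<open>\<bullet>\<close> 75)
  assumes permute_one [simp]: "1 \<bullet> x = x"
    and permute_times: "(p * q) \<bullet> x = p \<bullet> q \<bullet> x"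

definition (in pt) supp :: "'a \<Rightarrow> name set"
  where "supp x = {a. infinite {b. \<langle>a \<leftrightarrow> b\<rangle> \<bullet> x \<noteq> x}}"

class fs = pt +
  assumes finite_supp: "finite (supp x)"

class bn = fs +
  fixes bn :: "'a \<Rightarrow> name set"
  assumes bn_eqvt: "bn (p \<bullet> x) = apply p ` bn x"
    and finite_bn: "finite (bn x)"
    and bn_subset_supp: "bn x \<subseteq> supp x"

definition fresh_star :: "name set \<Rightarrow> 'a::pt \<Rightarrow> bool"  (infix \<open>\<sharp>*\<close> 55)
  where "B \<sharp>* x \<longleftrightarrow> (\<forall>a\<in>B. a \<notin> supp x)"

instantiation set :: (pt) pt
begin
definition permute_set :: "name perm \<Rightarrow> 'a set \<Rightarrow> 'a set"
  where "permute_set p X = permute p ` X"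
instance
  by standard (auto simp: permute_set_def permute_times image_image)
end

lemma permute_minus_cancel [simp]:
  "inverse p \<bullet> p \<bullet> x = x" "p \<bullet> inverse p \<bullet> (x::'a::pt) = x"
  by (simp_all flip: permute_times)

lemma permute_eq_iff [simp]: "p \<bullet> x = p \<bullet> y \<longleftrightarrow> x = (y::'a::pt)"
  by (metis permute_minus_cancel(1))

lemma apply_inverse_cancel [simp]:
  "inverse p \<langle>$\<rangle> (p \<langle>$\<rangle> a) = a" "p \<langle>$\<rangle> (inverse p \<langle>$\<rangle> a) = a"
  by (simp_all add: apply_sequence)

lemma swap_conj: "p * \<langle>a \<leftrightarrow> b\<rangle> = \<langle>p \<langle>$\<rangle> a \<leftrightarrow> p \<langle>$\<rangle> b\<rangle> * p"
proof (rule perm_eqI)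
  fix c
  show "(p * \<langle>a \<leftrightarrow> b\<rangle>) \<langle>$\<rangle> c = (\<langle>p \<langle>$\<rangle> a \<leftrightarrow> p \<langle>$\<rangle> b\<rangle> * p) \<langle>$\<rangle> c"
    by (cases "c = a"; cases "c = b") (simp_all add: apply_times apply_inj)
qed

lemma permute_swap: "p \<bullet> \<langle>a \<leftrightarrow> b\<rangle> \<bullet> x = \<langle>p \<langle>$\<rangle> a \<leftrightarrow> p \<langle>$\<rangle> b\<rangle> \<bullet> p \<bullet> (x::'a::pt)"
  by (metis swap_conj permute_times)

lemma infinite_apply_Collect:
  "infinite {b. Q (p \<langle>$\<rangle> b)} \<longleftrightarrow> infinite {b. Q b}"
proof -
  have "{b. Q b} = apply p ` {b. Q (p \<langle>$\<rangle> b)}"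
    by (auto simp: image_iff) (metis apply_inverse_cancel(2))
  moreover have "inj_on (apply p) X" for X
    by (simp add: apply_inj inj_on_def)
  ultimately show ?thesis
    by (metis finite_image_iff)
qed

lemma mem_image_apply: "a \<in> apply p ` X \<longleftrightarrow> inverse p \<langle>$\<rangle> a \<in> X"
  by (metis (no_types, lifting) apply_inverse_cancel image_iff)

lemma apply_mem_image [simp]: "p \<langle>$\<rangle> a \<in> apply p ` X \<longleftrightarrow> a \<in> X"
  by (simp add: mem_image_apply)

lemma supp_eqvt: "supp (p \<bullet> x) = apply p ` supp (x::'a::pt)"
proof -
  have "a \<in> supp (p \<bullet> x) \<longleftrightarrow> inverse p \<langle>$\<rangle> a \<in> supp x" for a
  proof -
    have "\<langle>a \<leftrightarrow> p \<langle>$\<rangle> b\<rangle> \<bullet> p \<bullet> x = p \<bullet> \<langle>inverse p \<langle>$\<rangle> a \<leftrightarrow> b\<rangle> \<bullet> x" for b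
      by (simp add: permute_swap)
    then show ?thesis
      unfolding supp_def mem_Collect_eq
      using infinite_apply_Collect[of "\<lambda>b. \<langle>a \<leftrightarrow> b\<rangle> \<bullet> p \<bullet> x \<noteq> p \<bullet> x" p] by simp
  qed
  then show ?thesis by (intro set_eqI) (simp only: mem_image_apply)
qed

lemma supp_supports_swap:
  assumes "a \<notin> supp x" "b \<notin> supp (x::'a::pt)"
  shows "\<langle>a \<leftrightarrow> b\<rangle> \<bullet> x = x"
proof -
  have "finite ({c. \<langle>a \<leftrightarrow> c\<rangle> \<bullet> x \<noteq> x} \<union> {c. \<langle>b \<leftrightarrow> c\<rangle> \<bullet> x \<noteq> x} \<union> {a, b})"
    using assms by (simp add: supp_def)
  from ex_new_if_finite[OF infinite_names this]
  obtain c where c: "\<langle>a \<leftrightarrow> c\<rangle> \<bullet> x = x" "\<langle>b \<leftrightarrow> c\<rangle> \<bullet> x = x" "c \<noteq> a" "c \<noteq> b"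
    by auto
  show ?thesis
  proof (cases "a = b")
    case False
    have "\<langle>a \<leftrightarrow> b\<rangle> = \<langle>a \<leftrightarrow> c\<rangle> * \<langle>b \<leftrightarrow> c\<rangle> * \<langle>a \<leftrightarrow> c\<rangle>"
    proof (rule perm_eqI)
      fix d
      show "\<langle>a \<leftrightarrow> b\<rangle> \<langle>$\<rangle> d = (\<langle>a \<leftrightarrow> c\<rangle> * \<langle>b \<leftrightarrow> c\<rangle> * \<langle>a \<leftrightarrow> c\<rangle>) \<langle>$\<rangle> d"
        using c False by (cases "d = a"; cases "d = b"; cases "d = c") (simp_all add: apply_times)
    qed
    then show ?thesis by (simp add: permute_times c)
  qed simp
qed

lemma supp_supports:
  assumes "\<forall>a\<in>supp x. p \<langle>$\<rangle> a = a"
  shows "p \<bullet> (x::'a::pt) = x"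
  using assms
proof (induction "card (affected p)" arbitrary: p rule: less_induct)
  case less
  show ?case
  proof (cases "p = 1")
    case False
    then obtain a where a: "p \<langle>$\<rangle> a \<noteq> a"
      by (auto simp: perm_eq_iff)
    define q where "q = \<langle>a \<leftrightarrow> p \<langle>$\<rangle> a\<rangle> * p"
    have pq: "p = \<langle>a \<leftrightarrow> p \<langle>$\<rangle> a\<rangle> * q"
      by (simp add: q_def flip: mult.assoc)
    have qa: "q \<langle>$\<rangle> c = (if p \<langle>$\<rangle> c = a then p \<langle>$\<rangle> a else if c = a then a else p \<langle>$\<rangle> c)" for c
      using a by (auto simp: q_def apply_times apply_inj)
    have sub: "affected q \<subseteq> affected p - {a}"
      using a by (auto simp: in_affected qa split: if_splits)
    then have "card (affected q) < card (affected p)"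
      using a by (intro psubset_card_mono) (auto simp: in_affected)
    moreover have "\<forall>a\<in>supp x. q \<langle>$\<rangle> a = a"
      using less.prems sub by (auto simp: in_affected)
    ultimately have "q \<bullet> x = x" by (rule less.hyps)
    moreover have "a \<notin> supp x" "p \<langle>$\<rangle> a \<notin> supp x"
      using less.prems a by (auto simp: apply_inj)
    ultimately show ?thesis
      by (subst pq) (simp add: permute_times supp_supports_swap)
  qed simp
qed

lemma supp_minimal:
  assumes "finite S" and S: "\<And>p. \<forall>a\<in>S. p \<langle>$\<rangle> a = a \<Longrightarrow> p \<bullet> x = x"
  shows "supp (x::'a::pt) \<subseteq> S"
proof
  fix a assume a: "a \<in> supp x"
  show "a \<in> S"
  proof (rule ccontr)
    assume "a \<notin> S"
    have "\<langle>a \<leftrightarrow> b\<rangle> \<bullet> x = x" if "b \<notin> S" for b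
      using that \<open>a \<notin> S\<close> by (intro S ballI apply_swap_same) auto
    then have "{b. \<langle>a \<leftrightarrow> b\<rangle> \<bullet> x \<noteq> x} \<subseteq> S"
      by auto
    then show False
      using a \<open>finite S\<close> by (auto simp: supp_def dest: finite_subset)
  qed
qed

text \<open>
  Raw formulas. The cardinal \<open>\<kappa>\<close> is the cardinality of the type \<open>'k\<close>;
  \<open>tConj I f\<close> stands for the conjunction of the \<open>f i\<close> with \<open>i \<in> I\<close>, and the values of \<open>f\<close>
  outside \<open>I\<close> are irrelevant. A subset \<open>I\<close> of \<open>'k\<close> can index any conjunct set
  of cardinality below \<open>\<kappa>\<close>.
\<close>

datatype ('p, 'a, 'k) tree =
    tConj "'k set" "'k \<Rightarrow> ('p, 'a, 'k) tree"
  | tNeg "('p, 'a, 'k) tree"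
  | tPred 'p
  | tAct 'a "('p, 'a, 'k) tree"

instantiation tree :: (pt, pt, type) pt
begin
primrec permute_tree :: "name perm \<Rightarrow> ('a, 'b, 'c) tree \<Rightarrow> ('a, 'b, 'c) tree" where
  "permute_tree p (tConj I f) = tConj I (\<lambda>i. permute_tree p (f i))"
| "permute_tree p (tNeg t) = tNeg (permute_tree p t)"
| "permute_tree p (tPred \<phi>) = tPred (p \<bullet> \<phi>)"
| "permute_tree p (tAct \<alpha> t) = tAct (p \<bullet> \<alpha>) (permute_tree p t)"
instance
proof
  show "1 \<bullet> t = t" for t :: "('a, 'b, 'c) tree"
    by (induction t) auto
  show "(p * q) \<bullet> t = p \<bullet> q \<bullet> t" for p q and t :: "('a, 'b, 'c) tree"
    by (induction t) (auto simp: permute_times)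
qed
end

text \<open>
  Alpha-equivalence. Conjunctions are compared as sets of conjuncts. In the clause for \<open>tAct\<close>
  the permutation fixes \<open>supp (\<alpha>, t) - bn \<alpha>\<close>, where the support of \<open>t\<close> is taken modulo
  alpha-equivalence (\<open>supp_alpha\<close> below, inlined because of the recursion): the syntactic names
  of an infinite conjunction can be more than its support. The term \<open>p \<bullet> u'\<close> replaces the
  condition \<open>alpha (p \<bullet> t) u\<close> by an equivalent one that is primitive recursive in \<open>t\<close>.
\<close>

primrec alpha :: "('p::pt, 'a::bn, 'k) tree \<Rightarrow> ('p, 'a, 'k) tree \<Rightarrow> bool" where
  "alpha (tConj I f) u = (\<exists>J g. u = tConj J g \<and>
     (\<forall>i\<in>I. \<exists>j\<in>J. alpha (f i) (g j)) \<and> (\<forall>j\<in>J. \<exists>i\<in>I. alpha (f i) (g j)))"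
| "alpha (tNeg t) u = (\<exists>u'. u = tNeg u' \<and> alpha t u')"
| "alpha (tPred \<phi>) u = (u = tPred \<phi>)"
| "alpha (tAct \<alpha> t) u = (\<exists>p u'. u = tAct (p \<bullet> \<alpha>) (p \<bullet> u') \<and> alpha t u' \<and>
     (\<forall>a \<in> (supp \<alpha> \<union> {a. infinite {b. \<not> alpha t (\<langle>a \<leftrightarrow> b\<rangle> \<bullet> t)}}) - bn \<alpha>. p \<langle>$\<rangle> a = a))"

definition supp_alpha :: "('p::pt, 'a::bn, 'k) tree \<Rightarrow> name set"
  where "supp_alpha t = {a. infinite {b. \<not> alpha t (\<langle>a \<leftrightarrow> b\<rangle> \<bullet> t)}}"

lemma alpha_tAct: "alpha (tAct \<alpha> t) u \<longleftrightarrow> (\<exists>p u'. u = tAct (p \<bullet> \<alpha>) (p \<bullet> u') \<and> alpha t u' \<and>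
     (\<forall>a \<in> (supp \<alpha> \<union> supp_alpha t) - bn \<alpha>. p \<langle>$\<rangle> a = a))"
  by (simp add: supp_alpha_def)

declare alpha.simps(4) [simp del]

lemma alpha_refl [simp]: "alpha t t"
proof (induction t)
  case (tAct \<alpha> t)
  then show ?case unfolding alpha_tAct by (intro exI[of _ 1] exI[of _ t]) simp
qed auto

lemma supp_alpha_eqvt_aux:
  assumes IH: "\<And>p u. alpha (p \<bullet> t) (p \<bullet> u) \<longleftrightarrow> alpha t u"
  shows "supp_alpha (p \<bullet> t) = apply p ` supp_alpha t"
proof -
  have "a \<in> supp_alpha (p \<bullet> t) \<longleftrightarrow> inverse p \<langle>$\<rangle> a \<in> supp_alpha t" for a
  proof -
    have "\<langle>a \<leftrightarrow> p \<langle>$\<rangle> b\<rangle> \<bullet> p \<bullet> t = p \<bullet> \<langle>inverse p \<langle>$\<rangle> a \<leftrightarrow> b\<rangle> \<bullet> t" for b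
      by (simp add: permute_swap)
    then show ?thesis
      unfolding supp_alpha_def mem_Collect_eq
      using infinite_apply_Collect[of "\<lambda>b. \<not> alpha (p \<bullet> t) (\<langle>a \<leftrightarrow> b\<rangle> \<bullet> p \<bullet> t)" p] by (simp add: IH)
  qed
  then show ?thesis by (intro set_eqI) (simp only: mem_image_apply)
qed

lemma alpha_eqvt_aux:
  assumes IH: "\<And>p u. alpha (p \<bullet> t) (p \<bullet> u) \<longleftrightarrow> alpha t u" and "alpha (tAct \<alpha> t) u"
  shows "alpha (p \<bullet> tAct \<alpha> t) (p \<bullet> u)"
proof -
  obtain q u' where q: "u = tAct (q \<bullet> \<alpha>) (q \<bullet> u')" "alpha t u'"
    "\<forall>a \<in> (supp \<alpha> \<union> supp_alpha t) - bn \<alpha>. q \<langle>$\<rangle> a = a"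
    using assms(2) unfolding alpha_tAct by auto
  have "p \<bullet> u = tAct ((p * q * inverse p) \<bullet> p \<bullet> \<alpha>) ((p * q * inverse p) \<bullet> p \<bullet> u')"
    by (simp add: q permute_times)
  moreover have "alpha (p \<bullet> t) (p \<bullet> u')"
    using q IH by simp
  moreover have "\<forall>a \<in> (supp (p \<bullet> \<alpha>) \<union> supp_alpha (p \<bullet> t)) - bn (p \<bullet> \<alpha>). (p * q * inverse p) \<langle>$\<rangle> a = a"
    using q(3) by (auto simp: supp_eqvt supp_alpha_eqvt_aux[OF IH] bn_eqvt apply_times)
  ultimately show ?thesis
    unfolding permute_tree.simps alpha_tAct by blast
qed

lemma alpha_eqvt [simp]: "alpha (p \<bullet> t) (p \<bullet> u) \<longleftrightarrow> alpha t u"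
proof (induction t arbitrary: u p)
  case (tConj I f)
  then show ?case by (cases u) auto
next
  case (tNeg t)
  then show ?case by (cases u) auto
next
  case (tPred \<phi>)
  then show ?case by (cases u) auto
next
  case (tAct \<alpha> t)
  have IH': "alpha (q \<bullet> p \<bullet> t) (q \<bullet> v) \<longleftrightarrow> alpha (p \<bullet> t) v" for q v
    using tAct.IH[of "q * p" "inverse p \<bullet> v"] tAct.IH[of p "inverse p \<bullet> v"]
    by (simp add: permute_times)
  show ?case
    using alpha_eqvt_aux[OF tAct.IH, of \<alpha> u p]
      alpha_eqvt_aux[OF IH', of "p \<bullet> \<alpha>" "p \<bullet> u" "inverse p"]
    by auto
qed

lemma supp_alpha_eqvt: "supp_alpha (p \<bullet> t) = apply p ` supp_alpha t"
  by (rule supp_alpha_eqvt_aux) simp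

lemma supp_alpha_cong:
  assumes E: "\<And>u v. alpha t u \<Longrightarrow> alpha t v \<longleftrightarrow> alpha u v" and "alpha t u"
  shows "supp_alpha u = supp_alpha t"
proof -
  have sw: "alpha t (p \<bullet> t) \<longleftrightarrow> alpha u (inverse p \<bullet> u)" for p
  proof -
    have sym: "alpha t v \<Longrightarrow> alpha v t" for v
      using E[of v t] by simp
    have "alpha t (p \<bullet> t) \<longleftrightarrow> alpha u (p \<bullet> t)"
      by (rule E) fact
    also have "\<dots> \<longleftrightarrow> alpha (inverse p \<bullet> u) t"
      using alpha_eqvt[of "inverse p" u "p \<bullet> t"] by simp
    also have "\<dots> \<longleftrightarrow> alpha t (inverse p \<bullet> u)"
    proof
      assume "alpha (inverse p \<bullet> u) t"
      then have "alpha u (p \<bullet> t)"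
        using alpha_eqvt[of "inverse p" u "p \<bullet> t"] by simp
      then have "alpha t (p \<bullet> t)"
        using E[OF \<open>alpha t u\<close>] by simp
      then have "alpha (p \<bullet> t) t"
        by (rule sym)
      then have "alpha t (inverse p \<bullet> t)"
        using alpha_eqvt[of "inverse p" "p \<bullet> t" t] by simp
      then have "alpha (inverse p \<bullet> t) v \<longleftrightarrow> alpha t v" for v
        using E by blast
      moreover have "alpha (inverse p \<bullet> t) (inverse p \<bullet> u)"
        using \<open>alpha t u\<close> by simp
      ultimately show "alpha t (inverse p \<bullet> u)" by blast
    qed (rule sym)
    also have "\<dots> \<longleftrightarrow> alpha u (inverse p \<bullet> u)"
      by (rule E) fact
    finally show ?thesis .
  qed
  from sw[of "\<langle>a \<leftrightarrow> b\<rangle>" for a b] show ?thesis by (simp add: supp_alpha_def)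
qed

lemma alpha_equiv:
  fixes t u v :: "('p::pt, 'a::bn, 'k) tree"
  shows "alpha t u \<Longrightarrow> alpha t v \<longleftrightarrow> alpha u v"
proof (induction t arbitrary: u v)
  case (tConj I f)
  then obtain J g where u: "u = tConj J g" "\<forall>i\<in>I. \<exists>j\<in>J. alpha (f i) (g j)" "\<forall>j\<in>J. \<exists>i\<in>I. alpha (f i) (g j)"
    by auto
  have E: "alpha (f i) w \<Longrightarrow> alpha (f i) v \<longleftrightarrow> alpha w v" for i w v
    using tConj.IH by blast
  have "(\<forall>i\<in>I. R (f i)) \<longleftrightarrow> (\<forall>j\<in>J. R (g j))"
    if R: "\<And>x y. (\<forall>w. alpha x w \<longleftrightarrow> alpha y w) \<Longrightarrow> R x \<longleftrightarrow> R y" for R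
  proof -
    have "R (f i) \<longleftrightarrow> R (g j)" if "alpha (f i) (g j)" for i j
      by (rule R) (simp add: E[OF that])
    then show ?thesis using u(2,3) by metis
  qed
  from this[of "\<lambda>x. \<exists>k\<in>K. alpha x (h k)" for K h]
  have "(\<forall>i\<in>I. \<exists>k\<in>K. alpha (f i) (h k)) \<longleftrightarrow> (\<forall>j\<in>J. \<exists>k\<in>K. alpha (g j) (h k))" for K :: "'k set" and h
    by simp
  moreover have "(\<exists>i\<in>I. alpha (f i) w) \<longleftrightarrow> (\<exists>j\<in>J. alpha (g j) w)" for w
  proof
    assume "\<exists>i\<in>I. alpha (f i) w"
    then obtain i where i: "i \<in> I" "alpha (f i) w" by auto
    with u(2) obtain j where "j \<in> J" "alpha (f i) (g j)" by auto
    with i E show "\<exists>j\<in>J. alpha (g j) w" by auto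
  next
    assume "\<exists>j\<in>J. alpha (g j) w"
    then obtain j where j: "j \<in> J" "alpha (g j) w" by auto
    with u(3) obtain i where "i \<in> I" "alpha (f i) (g j)" by auto
    with j E show "\<exists>i\<in>I. alpha (f i) w" by auto
  qed
  ultimately show ?case
    unfolding u(1) alpha.simps by simp
next
  case (tNeg t)
  then obtain u' where u: "u = tNeg u'" "alpha t u'" by auto
  show ?case using tNeg.IH[OF u(2)] by (simp add: u(1))
next
  case (tPred \<phi>)
  then show ?case by auto
next
  case (tAct \<alpha> t)
  from tAct.prems obtain p u' where p: "u = tAct (p \<bullet> \<alpha>) (p \<bullet> u')" "alpha t u'"
    "\<forall>a \<in> (supp \<alpha> \<union> supp_alpha t) - bn \<alpha>. p \<langle>$\<rangle> a = a"
    unfolding alpha_tAct by auto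
  define S where "S = (supp \<alpha> \<union> supp_alpha t) - bn \<alpha>"
  have "supp_alpha u' = supp_alpha t"
    using tAct.IH p(2) by (intro supp_alpha_cong) blast
  then have "(supp (p \<bullet> \<alpha>) \<union> supp_alpha (p \<bullet> u')) - bn (p \<bullet> \<alpha>) = apply p ` S"
    by (auto simp: S_def supp_eqvt supp_alpha_eqvt bn_eqvt apply_inj)
  also have "\<dots> = S"
    using p(3) by (auto simp: S_def)
  finally have S': "(supp (p \<bullet> \<alpha>) \<union> supp_alpha (p \<bullet> u')) - bn (p \<bullet> \<alpha>) = S" .
  have invp: "\<forall>a\<in>S. inverse p \<langle>$\<rangle> a = a"
    using p(3) unfolding S_def by (metis apply_inverse_cancel(1))
  show ?case
  proof
    assume "alpha (tAct \<alpha> t) v"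
    then obtain q v' where q: "v = tAct (q \<bullet> \<alpha>) (q \<bullet> v')" "alpha t v'" "\<forall>a\<in>S. q \<langle>$\<rangle> a = a"
      unfolding alpha_tAct S_def by auto
    have "alpha u' v'"
      using tAct.IH p(2) q(2) by blast
    then have "alpha (p \<bullet> u') (p \<bullet> v')" by simp
    moreover have "v = tAct ((q * inverse p) \<bullet> p \<bullet> \<alpha>) ((q * inverse p) \<bullet> p \<bullet> v')"
      by (simp add: q permute_times)
    moreover have "\<forall>a\<in>S. (q * inverse p) \<langle>$\<rangle> a = a"
      using q(3) invp by (simp add: apply_times)
    ultimately show "alpha u v"
      unfolding p(1) alpha_tAct S' by blast
  next
    assume "alpha u v"
    then obtain q v' where q: "v = tAct (q \<bullet> p \<bullet> \<alpha>) (q \<bullet> v')" "alpha (p \<bullet> u') v'" "\<forall>a\<in>S. q \<langle>$\<rangle> a = a"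
      unfolding alpha_tAct p(1) S' by auto
    have "alpha u' (inverse p \<bullet> v')"
      using q(2) by (metis alpha_eqvt permute_minus_cancel(1))
    then have "alpha t (inverse p \<bullet> v')"
      using tAct.IH p(2) by blast
    moreover have "v = tAct ((q * p) \<bullet> \<alpha>) ((q * p) \<bullet> inverse p \<bullet> v')"
      by (simp add: q permute_times)
    moreover have "\<forall>a\<in>S. (q * p) \<langle>$\<rangle> a = a"
      using q(3) p(3) by (simp add: apply_times S_def)
    ultimately show "alpha (tAct \<alpha> t) v"
      unfolding alpha_tAct S_def by blast
  qed
qed

lemma alpha_sym: "alpha t u \<Longrightarrow> alpha u t"
  using alpha_equiv alpha_refl by blast

lemma alpha_trans: "alpha t u \<Longrightarrow> alpha u v \<Longrightarrow> alpha t v"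
  using alpha_equiv by blast

lemma alpha_class_eq: "Collect (alpha t) = Collect (alpha u) \<longleftrightarrow> alpha t u"
  using alpha_equiv alpha_refl alpha_sym by (auto simp: set_eq_iff)

text \<open>
  At every conjunction, the set of alpha-equivalence classes of conjuncts has cardinality
  below \<open>\<kappa>\<close> and finite support. The support of this set is \<open>supp_alpha\<close> of the conjunction,
  cf. \<open>wf_tConj_iff\<close>.
\<close>

primrec wf_tree :: "('p::fs, 'a::bn, 'k) tree \<Rightarrow> bool" where
  "wf_tree (tConj I f) \<longleftrightarrow> (\<forall>i\<in>I. wf_tree (f i)) \<and>
     |(\<lambda>i. Collect (alpha (f i))) ` I| <o |UNIV :: 'k set| \<and> finite (supp_alpha (tConj I f))"
| "wf_tree (tNeg t) \<longleftrightarrow> wf_tree t"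
| "wf_tree (tPred \<phi>) \<longleftrightarrow> True"
| "wf_tree (tAct \<alpha> t) \<longleftrightarrow> wf_tree t"

lemma supp_alpha_alpha: "alpha t u \<Longrightarrow> supp_alpha u = supp_alpha t"
  by (rule supp_alpha_cong[OF alpha_equiv])

lemma alpha_classes_eqvt:
  "(\<lambda>i. Collect (alpha (p \<bullet> f i))) ` I = (\<lambda>S. permute p ` S) ` ((\<lambda>i. Collect (alpha (f i))) ` I)"
proof -
  have "Collect (alpha (p \<bullet> t)) = permute p ` Collect (alpha t)" for t :: "('a, 'b, 'c) tree"
  proof (rule set_eqI)
    fix u
    have "alpha (p \<bullet> t) u \<longleftrightarrow> alpha t (inverse p \<bullet> u)"
      using alpha_eqvt[of p t "inverse p \<bullet> u"] by simp
    then show "u \<in> Collect (alpha (p \<bullet> t)) \<longleftrightarrow> u \<in> permute p ` Collect (alpha t)"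
      by (auto simp: image_iff intro!: exI[of _ "inverse p \<bullet> u"])
  qed
  then show ?thesis by (simp add: image_image)
qed

lemma wf_tree_eqvt_imp: "wf_tree t \<Longrightarrow> wf_tree (p \<bullet> t)"
proof (induction t)
  case (tConj I f)
  have "|(\<lambda>i. Collect (alpha (p \<bullet> f i))) ` I| \<le>o |(\<lambda>i. Collect (alpha (f i))) ` I|"
    unfolding alpha_classes_eqvt by (rule card_of_image)
  moreover have "finite (supp_alpha (p \<bullet> tConj I f))"
    using tConj.prems unfolding supp_alpha_eqvt by simp
  ultimately show ?case
    using tConj by (auto intro: ordLeq_ordLess_trans)
qed auto

lemma wf_tree_eqvt [simp]: "wf_tree (p \<bullet> t) \<longleftrightarrow> wf_tree t"
  using wf_tree_eqvt_imp[of t p] wf_tree_eqvt_imp[of "p \<bullet> t" "inverse p"] by auto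

lemma wf_tree_alpha: "alpha t u \<Longrightarrow> wf_tree t \<Longrightarrow> wf_tree u"
proof (induction t arbitrary: u)
  case (tConj I f)
  then obtain J g where u: "u = tConj J g" "\<forall>i\<in>I. \<exists>j\<in>J. alpha (f i) (g j)" "\<forall>j\<in>J. \<exists>i\<in>I. alpha (f i) (g j)"
    by auto
  have "(\<lambda>i. Collect (alpha (f i))) ` I = (\<lambda>j. Collect (alpha (g j))) ` J"
    using u(2,3) by (fastforce simp: image_iff alpha_class_eq intro: alpha_sym)
  moreover have "supp_alpha u = supp_alpha (tConj I f)"
    using tConj.prems(1) by (rule supp_alpha_alpha)
  moreover have "wf_tree (g j)" if "j \<in> J" for j
  proof -
    from that u(3) obtain i where "i \<in> I" "alpha (f i) (g j)" by auto
    then show ?thesis using tConj by auto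
  qed
  ultimately show ?case
    using tConj.prems(2) u(1) by simp
next
  case (tAct \<alpha> t)
  from tAct.prems(1) obtain p u' where "u = tAct (p \<bullet> \<alpha>) (p \<bullet> u')" "alpha t u'"
    unfolding alpha_tAct by auto
  then show ?case using tAct by simp
qed auto

lemma finite_supp_alpha: "wf_tree t \<Longrightarrow> finite (supp_alpha t)"
proof (induction t)
  case (tNeg t)
  then show ?case by (simp add: supp_alpha_def)
next
  case (tPred \<phi>)
  have "\<langle>a \<leftrightarrow> b\<rangle> \<bullet> \<phi> = \<phi> \<longleftrightarrow> \<phi> = \<langle>a \<leftrightarrow> b\<rangle> \<bullet> \<phi>" for a b
    by auto
  then show ?case
    using finite_supp[of \<phi>] by (simp add: supp_alpha_def supp_def)
next
  case (tAct \<alpha> t)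
  have *: "alpha (tAct \<alpha> t) (\<langle>a \<leftrightarrow> b\<rangle> \<bullet> tAct \<alpha> t)"
    if "\<langle>a \<leftrightarrow> b\<rangle> \<bullet> \<alpha> = \<alpha>" "alpha t (\<langle>a \<leftrightarrow> b\<rangle> \<bullet> t)" for a b
    unfolding alpha_tAct using that by (intro exI[of _ 1]) simp
  have "supp_alpha (tAct \<alpha> t) \<subseteq> supp \<alpha> \<union> supp_alpha t"
  proof
    fix a assume a: "a \<in> supp_alpha (tAct \<alpha> t)"
    have "{b. \<not> alpha (tAct \<alpha> t) (\<langle>a \<leftrightarrow> b\<rangle> \<bullet> tAct \<alpha> t)} \<subseteq>
        {b. \<langle>a \<leftrightarrow> b\<rangle> \<bullet> \<alpha> \<noteq> \<alpha>} \<union> {b. \<not> alpha t (\<langle>a \<leftrightarrow> b\<rangle> \<bullet> t)}"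
      using * by blast
    with a show "a \<in> supp \<alpha> \<union> supp_alpha t"
      unfolding supp_alpha_def supp_def using finite_subset by auto
  qed
  then show ?case
    using tAct finite_supp[of \<alpha>] by (auto intro: finite_subset)
qed auto

quotient_type (overloaded) ('p, 'a, 'k) formula =
  "('p::fs, 'a::bn, 'k) tree" / partial: "\<lambda>t u. wf_tree t \<and> wf_tree u \<and> alpha t u"
proof (rule part_equivpI)
  show "\<exists>t. wf_tree t \<and> wf_tree t \<and> alpha t t"
    by (rule exI[of _ "tPred undefined"]) simp
qed (auto intro!: sympI transpI intro: alpha_sym alpha_trans)

lemma abs_formula_eq: "wf_tree t \<Longrightarrow> wf_tree u \<Longrightarrow> abs_formula t = abs_formula u \<longleftrightarrow> alpha t u"
  using Quotient3_rel[OF Quotient3_formula, of t u] by auto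

lemma abs_rep_formula [simp]: "abs_formula (rep_formula A) = A"
  by (rule Quotient3_abs_rep[OF Quotient3_formula])

lemma wf_rep_formula [simp]: "wf_tree (rep_formula A)"
  using Quotient3_rep_reflp[OF Quotient3_formula, of A] by simp

lemma alpha_rep_abs: "wf_tree t \<Longrightarrow> alpha (rep_formula (abs_formula t)) t"
  by (simp flip: abs_formula_eq)

instantiation formula :: (fs, bn, type) pt
begin

lift_definition permute_formula :: "name perm \<Rightarrow> ('a, 'b, 'c) formula \<Rightarrow> ('a, 'b, 'c) formula"
  is permute by simp

instance
proof
  show "1 \<bullet> A = A" for A :: "('a, 'b, 'c) formula"
    by transfer simp
  show "(p * q) \<bullet> A = p \<bullet> q \<bullet> A" for p q and A :: "('a, 'b, 'c) formula"
    by transfer (simp add: permute_times)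
qed

end

lemma permute_abs_formula: "wf_tree t \<Longrightarrow> p \<bullet> abs_formula t = abs_formula (p \<bullet> t)"
  by (simp add: permute_formula.abs_eq)

lemma supp_abs_formula:
  assumes "wf_tree t"
  shows "supp (abs_formula t) = supp_alpha t"
proof -
  have "\<langle>a \<leftrightarrow> b\<rangle> \<bullet> abs_formula t = abs_formula t \<longleftrightarrow> alpha t (\<langle>a \<leftrightarrow> b\<rangle> \<bullet> t)" for a b
    using assms alpha_sym by (auto simp: permute_abs_formula abs_formula_eq)
  then show ?thesis by (simp add: supp_def supp_alpha_def)
qed

lemma supp_rep_formula: "supp_alpha (rep_formula A) = supp A"
  by (simp flip: supp_abs_formula)

instance formula :: (fs, bn, type) fs
proof
  show "finite (supp A)" for A :: "('a, 'b, 'c) formula"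
    by (simp add: finite_supp_alpha flip: supp_rep_formula)
qed

definition conjunct_set :: "('p::fs, 'a::bn, 'k) formula set \<Rightarrow> bool"
  where "conjunct_set X \<longleftrightarrow> |X| <o |UNIV :: 'k set| \<and> finite (supp X)"

text \<open>
  Meaningful only if \<open>conjunct_set X\<close>. The choice of an indexing \<open>g\<close> of \<open>X\<close> is irrelevant,
  cf. \<open>Conj_abs\<close> and \<open>Conj_eq_iff\<close>.
\<close>

definition Conj :: "('p::fs, 'a::bn, 'k) formula set \<Rightarrow> ('p, 'a, 'k) formula"
  where "Conj X = (let g = (SOME g :: ('p, 'a, 'k) formula \<Rightarrow> 'k. inj_on g X)
    in abs_formula (tConj (g ` X) (\<lambda>i. rep_formula (inv_into X g i))))"

lift_definition Neg :: "('p::fs, 'a::bn, 'k) formula \<Rightarrow> ('p, 'a, 'k) formula"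
  is tNeg by simp

lift_definition Pred :: "'p \<Rightarrow> ('p::fs, 'a::bn, 'k) formula"
  is tPred by simp

lift_definition Act :: "'a \<Rightarrow> ('p::fs, 'a::bn, 'k) formula \<Rightarrow> ('p, 'a, 'k) formula"
  is tAct
  unfolding alpha_tAct wf_tree.simps by (metis alpha_tAct permute_one apply_one id_apply)

lemma alpha_tConj_iff:
  assumes "\<forall>i\<in>I. wf_tree (f i)" "\<forall>j\<in>J. wf_tree (g j)"
  shows "alpha (tConj I f) (tConj J g) \<longleftrightarrow> (\<lambda>i. abs_formula (f i)) ` I = (\<lambda>j. abs_formula (g j)) ` J"
proof -
  have "alpha (f i) (g j) \<longleftrightarrow> abs_formula (f i) = abs_formula (g j)" if "i \<in> I" "j \<in> J" for i j
    using that assms by (simp add: abs_formula_eq)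
  then have "alpha (tConj I f) (tConj J g) \<longleftrightarrow>
      (\<forall>i\<in>I. \<exists>j\<in>J. abs_formula (f i) = abs_formula (g j)) \<and>
      (\<forall>j\<in>J. \<exists>i\<in>I. abs_formula (f i) = abs_formula (g j))"
    by simp
  also have "\<dots> \<longleftrightarrow> (\<lambda>i. abs_formula (f i)) ` I \<subseteq> (\<lambda>j. abs_formula (g j)) ` J \<and>
      (\<lambda>j. abs_formula (g j)) ` J \<subseteq> (\<lambda>i. abs_formula (f i)) ` I"
    by (simp only: image_subset_iff image_iff eq_commute)
  finally show ?thesis by (simp only: set_eq_subset)
qed

lemma wf_tConj_iff:
  fixes f :: "'k \<Rightarrow> ('p::fs, 'a::bn, 'k) tree"
  assumes "\<forall>i\<in>I. wf_tree (f i)"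
  shows "wf_tree (tConj I f) \<longleftrightarrow> conjunct_set ((\<lambda>i. abs_formula (f i)) ` I)"
proof -
  define X where "X = (\<lambda>i. abs_formula (f i)) ` I"
  have "Collect (alpha (rep_formula (abs_formula (f i)))) = Collect (alpha (f i))" if "i \<in> I" for i
    using assms that by (simp add: alpha_class_eq alpha_rep_abs)
  then have "(\<lambda>i. Collect (alpha (f i))) ` I = (\<lambda>A. Collect (alpha (rep_formula A))) ` X"
    by (auto simp: X_def image_image)
  moreover have "inj_on (\<lambda>A. Collect (alpha (rep_formula A))) X"
    by (simp add: inj_on_def alpha_class_eq flip: abs_formula_eq)
  ultimately have "|(\<lambda>i. Collect (alpha (f i))) ` I| =o |X|"
    by (metis bij_betw_imageI card_of_ordIsoI ordIso_symmetric)
  then have c: "|(\<lambda>i. Collect (alpha (f i))) ` I| <o r \<longleftrightarrow> |X| <o r" for r :: "'k rel"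
    by (meson ordIso_ordLess_trans ordIso_symmetric)
  have "p \<bullet> X = (\<lambda>i. abs_formula (p \<bullet> f i)) ` I" for p
    using assms by (auto simp: X_def permute_set_def image_image permute_abs_formula)
  then have "p \<bullet> X = X \<longleftrightarrow> alpha (tConj I f) (p \<bullet> tConj I f)" for p
    using alpha_tConj_iff[of I f I "\<lambda>i. p \<bullet> f i"] assms by (auto simp: X_def)
  then have "supp X = supp_alpha (tConj I f)"
    by (simp only: supp_def supp_alpha_def)
  with c show ?thesis
    using assms by (simp add: conjunct_set_def X_def)
qed

lemma Conj_abs:
  fixes f :: "'k \<Rightarrow> ('p::fs, 'a::bn, 'k) tree"
  assumes "\<forall>i\<in>I. wf_tree (f i)" "conjunct_set ((\<lambda>i. abs_formula (f i)) ` I)"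
  shows "Conj ((\<lambda>i. abs_formula (f i)) ` I) = abs_formula (tConj I f)"
proof -
  define X where "X = (\<lambda>i. abs_formula (f i)) ` I"
  define g where "g = (SOME g :: ('p, 'a, 'k) formula \<Rightarrow> 'k. inj_on g X)"
  have "\<exists>g :: ('p, 'a, 'k) formula \<Rightarrow> 'k. inj_on g X"
    using assms(2) by (metis X_def card_of_ordLeq conjunct_set_def ordLess_imp_ordLeq)
  then have g: "inj_on g X"
    unfolding g_def by (rule someI_ex)
  have img: "(\<lambda>i. abs_formula (rep_formula (inv_into X g i))) ` g ` X = X"
    using g by (simp add: image_image)
  have "wf_tree (tConj (g ` X) (\<lambda>i. rep_formula (inv_into X g i)))"
    using assms(2) img by (subst wf_tConj_iff) (simp_all add: X_def)
  moreover have "wf_tree (tConj I f)"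
    using assms by (simp only: wf_tConj_iff)
  moreover have "alpha (tConj (g ` X) (\<lambda>i. rep_formula (inv_into X g i))) (tConj I f)"
    using assms(1) img by (subst alpha_tConj_iff) (simp_all add: X_def)
  ultimately have "Conj X = abs_formula (tConj I f)"
    by (simp add: Conj_def abs_formula_eq flip: g_def del: wf_tree.simps alpha.simps)
  then show ?thesis by (simp add: X_def)
qed

lemma Conj_repr:
  assumes "conjunct_set (X :: ('p::fs, 'a::bn, 'k) formula set)"
  obtains I :: "'k set" and f where "\<forall>i\<in>I. wf_tree (f i)" "X = (\<lambda>i. abs_formula (f i)) ` I"
    "wf_tree (tConj I f)" "Conj X = abs_formula (tConj I f)"
proof -
  obtain g :: "('p, 'a, 'k) formula \<Rightarrow> 'k" where g: "inj_on g X"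
    using assms by (metis card_of_ordLeq conjunct_set_def ordLess_imp_ordLeq)
  have img: "X = (\<lambda>i. abs_formula (rep_formula (inv_into X g i))) ` g ` X"
    using g by (simp add: image_image)
  show ?thesis
  proof (rule that[of "g ` X" "\<lambda>i. rep_formula (inv_into X g i)"])
    show "wf_tree (tConj (g ` X) (\<lambda>i. rep_formula (inv_into X g i)))"
      using assms g by (subst wf_tConj_iff) (simp_all add: image_image)
    show "Conj X = abs_formula (tConj (g ` X) (\<lambda>i. rep_formula (inv_into X g i)))"
      using Conj_abs[of "g ` X" "\<lambda>i. rep_formula (inv_into X g i)"] assms unfolding img[symmetric] by simp
  qed (use img in auto)
qed

lemma Neg_abs: "wf_tree t \<Longrightarrow> Neg (abs_formula t) = abs_formula (tNeg t)"
  by (simp add: Neg.abs_eq)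

lemma Act_abs: "wf_tree t \<Longrightarrow> Act \<alpha> (abs_formula t) = abs_formula (tAct \<alpha> t)"
  by (simp add: Act.abs_eq)

lemma Pred_abs: "Pred \<phi> = abs_formula (tPred \<phi>)"
  by (simp add: Pred.abs_eq)

lemma formula_repr:
  obtains t where "A = abs_formula t" "wf_tree t"
  by (metis abs_rep_formula wf_rep_formula)

lemma formula_exhaust:
  obtains (Conj) X where "conjunct_set X" "A = Conj X"
    | (Neg) B where "A = Neg B"
    | (Pred) \<phi> where "A = Pred \<phi>"
    | (Act) \<alpha> B where "A = Act \<alpha> B"
proof (cases A rule: formula_repr)
  case (1 t)
  show thesis
  proof (cases t)
    case (tConj I f)
    then have w: "\<forall>i\<in>I. wf_tree (f i)" using 1 by auto
    then have "conjunct_set ((\<lambda>i. abs_formula (f i)) ` I)"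
      using 1 tConj by (simp only: wf_tConj_iff)
    with w 1 tConj show ?thesis using Conj Conj_abs by metis
  next
    case (tNeg u)
    then show ?thesis using 1 Neg Neg_abs by (metis wf_tree.simps(2))
  next
    case (tPred \<phi>)
    then show ?thesis using 1 Pred Pred_abs by metis
  next
    case (tAct \<alpha> u)
    then show ?thesis using 1 Act Act_abs by (metis wf_tree.simps(4))
  qed
qed

lemma Conj_eq_iff:
  assumes "conjunct_set X" "conjunct_set Y"
  shows "Conj X = Conj Y \<longleftrightarrow> X = Y"
proof -
  obtain I f where X: "\<forall>i\<in>I. wf_tree (f i)" "X = (\<lambda>i. abs_formula (f i)) ` I"
    "wf_tree (tConj I f)" "Conj X = abs_formula (tConj I f)"
    by (rule Conj_repr[OF assms(1)])
  obtain J g where Y: "\<forall>i\<in>J. wf_tree (g i)" "Y = (\<lambda>i. abs_formula (g i)) ` J"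
    "wf_tree (tConj J g)" "Conj Y = abs_formula (tConj J g)"
    by (rule Conj_repr[OF assms(2)])
  show ?thesis
    using X Y by (simp add: abs_formula_eq alpha_tConj_iff del: wf_tree.simps alpha.simps)
qed

lemma Neg_eq_iff [simp]: "Neg A = Neg B \<longleftrightarrow> A = B"
  by (cases A rule: formula_repr; cases B rule: formula_repr) (simp add: Neg_abs abs_formula_eq)

lemma Pred_eq_iff [simp]: "Pred \<phi> = Pred \<psi> \<longleftrightarrow> \<phi> = \<psi>"
  by (auto simp add: Pred_abs abs_formula_eq)

lemma Act_eq_iff:
  "Act \<alpha> A = Act \<beta> B \<longleftrightarrow>
    (\<exists>p. p \<bullet> \<alpha> = \<beta> \<and> p \<bullet> A = B \<and> (\<forall>a \<in> (supp \<alpha> \<union> supp A) - bn \<alpha>. p \<langle>$\<rangle> a = a))"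
proof (cases A rule: formula_repr; cases B rule: formula_repr)
  fix t u assume t: "A = abs_formula t" "wf_tree t" and u: "B = abs_formula u" "wf_tree u"
  have "Act \<alpha> A = Act \<beta> B \<longleftrightarrow> alpha (tAct \<alpha> t) (tAct \<beta> u)"
    by (simp add: t u Act_abs abs_formula_eq)
  also have "\<dots> \<longleftrightarrow> (\<exists>p. p \<bullet> \<alpha> = \<beta> \<and> alpha t (inverse p \<bullet> u) \<and>
     (\<forall>a \<in> (supp \<alpha> \<union> supp_alpha t) - bn \<alpha>. p \<langle>$\<rangle> a = a))"
    unfolding alpha_tAct by (rule ex_cong1) (metis permute_minus_cancel tree.inject(4))
  also have "\<dots> \<longleftrightarrow> (\<exists>p. p \<bullet> \<alpha> = \<beta> \<and> p \<bullet> A = B \<and> (\<forall>a \<in> (supp \<alpha> \<union> supp A) - bn \<alpha>. p \<langle>$\<rangle> a = a))"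
  proof (rule ex_cong1)
    fix p
    have "alpha t (inverse p \<bullet> u) \<longleftrightarrow> alpha (p \<bullet> t) u"
      using alpha_eqvt[of p t "inverse p \<bullet> u"] by simp
    then show "(p \<bullet> \<alpha> = \<beta> \<and> alpha t (inverse p \<bullet> u) \<and> (\<forall>a \<in> (supp \<alpha> \<union> supp_alpha t) - bn \<alpha>. p \<langle>$\<rangle> a = a))
      = (p \<bullet> \<alpha> = \<beta> \<and> p \<bullet> A = B \<and> (\<forall>a \<in> (supp \<alpha> \<union> supp A) - bn \<alpha>. p \<langle>$\<rangle> a = a))"
      using t u by (simp add: permute_abs_formula abs_formula_eq supp_abs_formula)
  qed
  finally show ?thesis .
qed

lemma formula_distinct [simp]:
  "Neg A \<noteq> Pred \<phi>" "Pred \<phi> \<noteq> Neg A" "Neg A \<noteq> Act \<alpha> B" "Act \<alpha> B \<noteq> Neg A"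
  "Pred \<phi> \<noteq> Act \<alpha> B" "Act \<alpha> B \<noteq> Pred \<phi>"
  by (cases A rule: formula_repr; cases B rule: formula_repr;
      auto simp: Neg_abs Act_abs Pred_abs abs_formula_eq alpha_tAct)+

lemma Conj_distinct:
  assumes "conjunct_set X"
  shows "Conj X \<noteq> Neg A" "Conj X \<noteq> Pred \<phi>" "Conj X \<noteq> Act \<alpha> A"
    "Neg A \<noteq> Conj X" "Pred \<phi> \<noteq> Conj X" "Act \<alpha> A \<noteq> Conj X"
proof -
  obtain I f where X: "\<forall>i\<in>I. wf_tree (f i)" "X = (\<lambda>i. abs_formula (f i)) ` I"
    "wf_tree (tConj I f)" "Conj X = abs_formula (tConj I f)"
    by (rule Conj_repr[OF assms])
  obtain t where t: "A = abs_formula t" "wf_tree t" by (rule formula_repr)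
  have *: "abs_formula (tConj I f) = abs_formula u \<longleftrightarrow> alpha (tConj I f) u" if "wf_tree u" for u
    using X(3) that by (rule abs_formula_eq)
  show "Conj X \<noteq> Neg A" "Conj X \<noteq> Pred \<phi>" "Conj X \<noteq> Act \<alpha> A"
    using t by (simp_all add: X(4) Neg_abs Pred_abs Act_abs *)
  then show "Neg A \<noteq> Conj X" "Pred \<phi> \<noteq> Conj X" "Act \<alpha> A \<noteq> Conj X"
    by metis+
qed

lemma conjunct_set_eqvt: "conjunct_set X \<Longrightarrow> conjunct_set (p \<bullet> X)"
  unfolding conjunct_set_def supp_eqvt
  by (auto simp: permute_set_def intro: ordLeq_ordLess_trans[OF card_of_image])

lemma Neg_eqvt: "p \<bullet> Neg A = Neg (p \<bullet> A)"
  by (cases A rule: formula_repr) (simp add: Neg_abs permute_abs_formula)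

lemma Pred_eqvt: "p \<bullet> Pred \<phi> = Pred (p \<bullet> \<phi>)"
  by (simp add: Pred_abs permute_abs_formula)

lemma Act_eqvt: "p \<bullet> Act \<alpha> A = Act (p \<bullet> \<alpha>) (p \<bullet> A)"
  by (cases A rule: formula_repr) (simp add: Act_abs permute_abs_formula)

lemma Conj_eqvt:
  assumes "conjunct_set X"
  shows "p \<bullet> Conj X = Conj (p \<bullet> X)"
proof -
  obtain I f where X: "\<forall>i\<in>I. wf_tree (f i)" "X = (\<lambda>i. abs_formula (f i)) ` I"
    "wf_tree (tConj I f)" "Conj X = abs_formula (tConj I f)"
    by (rule Conj_repr[OF assms])
  have pX: "p \<bullet> X = (\<lambda>i. abs_formula (p \<bullet> f i)) ` I"
    using X(1) by (auto simp: X(2) permute_set_def image_image permute_abs_formula)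
  have "Conj (p \<bullet> X) = abs_formula (tConj I (\<lambda>i. p \<bullet> f i))"
    unfolding pX using X(1) conjunct_set_eqvt[OF assms, of p] by (intro Conj_abs) (simp_all flip: pX)
  then show ?thesis
    by (simp add: X(4) permute_abs_formula[OF X(3)])
qed

inductive immediate_subformula :: "('p::fs, 'a::bn, 'k) formula \<Rightarrow> ('p, 'a, 'k) formula \<Rightarrow> bool" where
  "conjunct_set X \<Longrightarrow> A \<in> X \<Longrightarrow> immediate_subformula A (Conj X)"
| "immediate_subformula A (Neg A)"
| "immediate_subformula A (Act \<alpha> A)"

lemma wfP_immediate_subformula: "wfP immediate_subformula"
proof -
  have acc: "Wellfounded.accp immediate_subformula (p \<bullet> abs_formula t)" if "wf_tree t" for p and t :: "('a, 'b, 'c) tree"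
    using that
  proof (induction t arbitrary: p)
    case (tConj I f)
    define X where "X = (\<lambda>i. p \<bullet> abs_formula (f i)) ` I"
    have w: "\<forall>i\<in>I. wf_tree (f i)" using tConj.prems by simp
    then have X: "X = (\<lambda>i. abs_formula (p \<bullet> f i)) ` I"
      by (auto simp: X_def permute_abs_formula)
    have wf: "wf_tree (tConj I (\<lambda>i. p \<bullet> f i))"
      using wf_tree_eqvt[of p "tConj I f"] tConj.prems by simp
    then have cX: "conjunct_set X"
      unfolding X using w by (subst (asm) wf_tConj_iff) simp_all
    have "p \<bullet> abs_formula (tConj I f) = Conj X"
      using Conj_abs[of I "\<lambda>i. p \<bullet> f i"] w cX tConj.prems
      by (simp add: X permute_abs_formula)
    moreover have "Wellfounded.accp immediate_subformula (Conj X)"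
    proof (rule accp.accI)
      fix B assume "immediate_subformula B (Conj X)"
      then have "B \<in> X"
        by cases (use cX in \<open>auto simp: Conj_eq_iff Conj_distinct\<close>)
      then show "Wellfounded.accp immediate_subformula B"
        using tConj.IH w by (auto simp: X_def)
    qed
    ultimately show ?case by simp
  next
    case (tNeg t)
    show ?case
    proof (rule accp.accI)
      fix B assume "immediate_subformula B (p \<bullet> abs_formula (tNeg t))"
      then have "immediate_subformula B (Neg (p \<bullet> abs_formula t))"
        using tNeg.prems by (simp flip: Neg_abs add: Neg_eqvt)
      then have "B = p \<bullet> abs_formula t"
        by cases (auto simp: Conj_distinct)
      then show "Wellfounded.accp immediate_subformula B"
        using tNeg by simp
    qed
  next
    case (tPred \<phi>)
    show ?case
    proof (rule accp.accI)
      fix B assume "immediate_subformula B (p \<bullet> abs_formula (tPred \<phi>))"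
      then have "immediate_subformula B (Pred (p \<bullet> \<phi>))"
        by (simp flip: Pred_abs add: Pred_eqvt)
      then show "Wellfounded.accp immediate_subformula B"
        by cases (auto simp: Conj_distinct)
    qed
  next
    case (tAct \<alpha> t)
    show ?case
    proof (rule accp.accI)
      fix B assume "immediate_subformula B (p \<bullet> abs_formula (tAct \<alpha> t))"
      then have "immediate_subformula B (Act (p \<bullet> \<alpha>) (p \<bullet> abs_formula t))"
        using tAct.prems by (simp flip: Act_abs add: Act_eqvt)
      then obtain q where "B = q \<bullet> p \<bullet> abs_formula t"
        by cases (auto simp: Conj_distinct Act_eq_iff)
      then have "B = (q * p) \<bullet> abs_formula t"
        by (simp add: permute_times)
      then show "Wellfounded.accp immediate_subformula B"
        using tAct by simp
    qed
  qed
  show ?thesis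
  proof (rule accp_wfpI, rule allI)
    fix A :: "('a, 'b, 'c) formula"
    show "Wellfounded.accp immediate_subformula A"
      using acc[of "rep_formula A" 1] by simp
  qed
qed

definition Disj :: "('p::fs, 'a::bn, 'k) formula set \<Rightarrow> ('p, 'a, 'k) formula"
  where "Disj X = Neg (Conj (Neg ` X))"

locale nominal_transition_system =
  fixes entails :: "'s::fs \<Rightarrow> 'p::fs \<Rightarrow> bool"  (infix \<open>\<turnstile>\<close> 50)
    and step :: "'s \<Rightarrow> 'a::bn \<Rightarrow> 's \<Rightarrow> bool"
    and tau :: 'a
  assumes entails_eqvt: "P \<turnstile> \<phi> \<Longrightarrow> p \<bullet> P \<turnstile> p \<bullet> \<phi>"
    and step_eqvt: "step P \<alpha> P' \<Longrightarrow> step (p \<bullet> P) (p \<bullet> \<alpha>) (p \<bullet> P')"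
    and step_alpha: "step P \<alpha> P' \<Longrightarrow> \<forall>a \<in> (supp \<alpha> \<union> supp P') - bn \<alpha>. p \<langle>$\<rangle> a = a \<Longrightarrow>
      step P (p \<bullet> \<alpha>) (p \<bullet> P')"
    and supp_tau: "supp tau = {}"
begin

inductive weak_tau_step :: "'s \<Rightarrow> 's \<Rightarrow> bool"  (infix \<open>\<Rightarrow>\<^sub>\<tau>\<close> 50) where
  "P \<Rightarrow>\<^sub>\<tau> P"
| "step P tau P'' \<Longrightarrow> P'' \<Rightarrow>\<^sub>\<tau> P' \<Longrightarrow> P \<Rightarrow>\<^sub>\<tau> P'"

definition weak_step :: "'s \<Rightarrow> 'a \<Rightarrow> 's \<Rightarrow> bool"
  where "weak_step P \<alpha> P' \<longleftrightarrow> (\<exists>P\<^sub>1 P\<^sub>2. P \<Rightarrow>\<^sub>\<tau> P\<^sub>1 \<and> step P\<^sub>1 \<alpha> P\<^sub>2 \<and> P\<^sub>2 \<Rightarrow>\<^sub>\<tau> P')"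

definition weak_step_hat :: "'s \<Rightarrow> 'a \<Rightarrow> 's \<Rightarrow> bool"
  where "weak_step_hat P \<alpha> P' \<longleftrightarrow> (if \<alpha> = tau then P \<Rightarrow>\<^sub>\<tau> P' else weak_step P \<alpha> P')"

definition weak_simulation :: "('s \<Rightarrow> 's \<Rightarrow> bool) \<Rightarrow> bool"
  where "weak_simulation R \<longleftrightarrow> (\<forall>P Q. R P Q \<longrightarrow>
    (\<forall>\<alpha> P'. bn \<alpha> \<sharp>* Q \<longrightarrow> step P \<alpha> P' \<longrightarrow> (\<exists>Q'. weak_step_hat Q \<alpha> Q' \<and> R P' Q')))"

definition weak_static_implication :: "('s \<Rightarrow> 's \<Rightarrow> bool) \<Rightarrow> bool"
  where "weak_static_implication R \<longleftrightarrow> (\<forall>P Q. R P Q \<longrightarrow>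
    (\<forall>\<phi>. P \<turnstile> \<phi> \<longrightarrow> (\<exists>Q'. Q \<Rightarrow>\<^sub>\<tau> Q' \<and> Q' \<turnstile> \<phi> \<and> R P Q')))"

definition weak_bisimulation :: "('s \<Rightarrow> 's \<Rightarrow> bool) \<Rightarrow> bool"
  where "weak_bisimulation R \<longleftrightarrow> symp R \<and> weak_simulation R \<and> weak_static_implication R"

definition weakly_bisimilar :: "'s \<Rightarrow> 's \<Rightarrow> bool"
  where "weakly_bisimilar P Q \<longleftrightarrow> (\<exists>R. weak_bisimulation R \<and> R P Q)"

context
  notes conj_cong [fundef_cong]
begin

function satisfies :: "'s \<Rightarrow> ('p, 'a, 'k) formula \<Rightarrow> bool"  (infix \<open>\<Turnstile>\<close> 50) where
  "conjunct_set X \<Longrightarrow> P \<Turnstile> Conj X \<longleftrightarrow> (\<forall>A\<in>X. P \<Turnstile> A)"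
| "P \<Turnstile> Neg A \<longleftrightarrow> \<not> P \<Turnstile> A"
| "P \<Turnstile> Pred \<phi> \<longleftrightarrow> P \<turnstile> \<phi>"
| "P \<Turnstile> Act \<alpha> A \<longleftrightarrow> (\<exists>\<alpha>' A' P'. Act \<alpha> A = Act \<alpha>' A' \<and> bn \<alpha>' \<sharp>* P \<and> step P \<alpha>' P' \<and> P' \<Turnstile> A')"
proof goal_cases
  case (1 R x)
  obtain P A where x: "x = (P, A)" by (cases x)
  show ?case
    by (cases A rule: formula_exhaust) (use 1 x in blast)+
qed (simp_all add: Conj_eq_iff Conj_distinct)
termination
proof (relation "inv_image {(A, B). immediate_subformula A B} snd")
  show "wf (inv_image {(A, B). immediate_subformula A B} (snd :: 's \<times> ('p, 'a, 'k) formula \<Rightarrow> _))"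
    using wfP_immediate_subformula by (intro wf_inv_image) (simp add: wfp_def)
qed (auto intro: immediate_subformula.intros)

end

definition weak_diamond_tau :: "('p, 'a, 'k) formula \<Rightarrow> ('p, 'a, 'k) formula"
  where "weak_diamond_tau A = Disj (range (\<lambda>i::nat. (Act tau ^^ i) A))"

definition weak_diamond :: "'a \<Rightarrow> ('p, 'a, 'k) formula \<Rightarrow> ('p, 'a, 'k) formula"
  where "weak_diamond \<alpha> A =
    (if \<alpha> = tau then weak_diamond_tau A else weak_diamond_tau (Act \<alpha> (weak_diamond_tau A)))"

inductive weak_formula :: "('p, 'a, 'k) formula \<Rightarrow> bool" where
  "conjunct_set X \<Longrightarrow> (\<And>A. A \<in> X \<Longrightarrow> weak_formula A) \<Longrightarrow> weak_formula (Conj X)"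
| "weak_formula A \<Longrightarrow> weak_formula (Neg A)"
| "weak_formula A \<Longrightarrow> weak_formula (weak_diamond \<alpha> A)"
| "weak_formula A \<Longrightarrow> weak_formula (weak_diamond tau (Conj {A, Pred \<phi>}))"

text \<open>The argument of type \<open>'k itself\<close> only serves to fix \<open>\<kappa>\<close>.\<close>

definition weakly_logically_equivalent :: "'k itself \<Rightarrow> 's \<Rightarrow> 's \<Rightarrow> bool"
  where "weakly_logically_equivalent \<kappa> P Q \<longleftrightarrow>
    (\<forall>A :: ('p, 'a, 'k) formula. weak_formula A \<longrightarrow> (P \<Turnstile> A \<longleftrightarrow> Q \<Turnstile> A))"

end

lemma conjunct_setI_bounded_supp:
  assumes "|X| <o |UNIV :: 'k set|" "finite S" "\<And>A. A \<in> X \<Longrightarrow> supp A \<subseteq> S"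
  shows "conjunct_set (X :: ('p::fs, 'a::bn, 'k) formula set)"
proof -
  have "p \<bullet> X = X" if "\<forall>a\<in>S. p \<langle>$\<rangle> a = a" for p
  proof -
    have "p \<bullet> A = A" if "A \<in> X" for A
      using assms(3)[OF that] \<open>\<forall>a\<in>S. p \<langle>$\<rangle> a = a\<close> by (intro supp_supports) auto
    then show ?thesis by (simp add: permute_set_def)
  qed
  then have "supp X \<subseteq> S"
    using assms(2) by (intro supp_minimal)
  then show ?thesis
    using assms(1,2) finite_subset by (auto simp: conjunct_set_def)
qed

lemma supp_subset_if_fixed:
  assumes "\<And>p. p \<bullet> x = x \<Longrightarrow> p \<bullet> y = y"
  shows "supp (y::'b::pt) \<subseteq> supp (x::'a::pt)"
proof
  fix a assume "a \<in> supp y"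
  moreover have "{b. \<langle>a \<leftrightarrow> b\<rangle> \<bullet> y \<noteq> y} \<subseteq> {b. \<langle>a \<leftrightarrow> b\<rangle> \<bullet> x \<noteq> x}"
    using assms by auto
  ultimately show "a \<in> supp x"
    unfolding supp_def using finite_subset by auto
qed

context nominal_transition_system
begin

lemma tau_eqvt: "p \<bullet> tau = tau"
  by (rule supp_supports) (simp add: supp_tau)

lemma Act_tau_power_eqvt: "p \<bullet> (Act tau ^^ i) A = (Act tau ^^ i) (p \<bullet> A)"
  by (induction i) (simp_all add: Act_eqvt tau_eqvt)

lemma conjunct_set_weak_diamond_tau:
  fixes A :: "('p, 'a, 'k) formula"
  assumes "natLeq <o |UNIV :: 'k set|"
  shows "conjunct_set (Neg ` range (\<lambda>i::nat. (Act tau ^^ i) A))"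
proof (rule conjunct_setI_bounded_supp[where S = "supp A"])
  have "|Neg ` range (\<lambda>i::nat. (Act tau ^^ i) A)| \<le>o |UNIV :: nat set|"
    by (simp only: image_image card_of_image)
  then show "|Neg ` range (\<lambda>i::nat. (Act tau ^^ i) A)| <o |UNIV :: 'k set|"
    using assms card_of_nat by (meson ordLeq_ordIso_trans ordLeq_ordLess_trans)
next
  fix B assume "B \<in> Neg ` range (\<lambda>i::nat. (Act tau ^^ i) A)"
  then show "supp B \<subseteq> supp A"
    by (intro supp_subset_if_fixed) (auto simp: Neg_eqvt Act_tau_power_eqvt)
qed (rule finite_supp)

end

end

theory Submission
  imports Defs
begin

text \<open>
  Induction on the weak formula, simultaneously for all pairs of weakly bisimilar states. The
  delicate case is \<open>\<langle>\<langle>\<alpha>\<rangle>\<rangle>A\<close>: the binding names of \<open>\<alpha>\<close> must be fresh for the state that simulates the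
  \<open>\<alpha>\<close>-transition, and a matching weak transition may pass through states in which they are no
  longer fresh. Both problems are solved by renaming the binding names simultaneously in the
  transition and in the formula, since satisfaction and weak bisimilarity are equivariant.
\<close>

section \<open>Renaming names away from a finite set, and finite conjunct sets\<close>

lemma ex_perm_fresh:
  fixes B S :: "name set"
  assumes "finite B" "finite S"
  shows "\<exists>p. (\<forall>a\<in>S - B. p \<langle>$\<rangle> a = a) \<and> apply p ` B \<inter> S = {}"
  using assms
proof (induction B arbitrary: S rule: finite_induct)
  case empty
  show ?case by (intro exI[of _ 1]) simp
next
  case (insert a B)
  \<comment> \<open>Instantiating the hypothesis with \<open>insert a S\<close> protects
    \<open>a\<close>: as \<open>a\<close> is not in \<open>B\<close>, \<open>p\<close> fixes it, and
    no name of \<open>B\<close> is sent to it. Swapping \<open>a\<close> with a new \<open>c\<close>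
    then leaves the images of \<open>B\<close> alone.\<close>
  obtain p where p: "\<forall>x\<in>insert a S - B. p \<langle>$\<rangle> x = x" "apply p ` B \<inter> insert a S = {}"
    using insert.IH[of "insert a S"] insert.prems by auto
  have "finite (insert a (S \<union> apply p ` B))"
    using insert by simp
  from ex_new_if_finite[OF infinite_names this]
  obtain c where c: "c \<noteq> a" "c \<notin> S" "c \<notin> apply p ` B"
    by auto
  have "(\<langle>a \<leftrightarrow> c\<rangle> * p) \<langle>$\<rangle> x = x" if "x \<in> S - insert a B" for x
    using that p(1) c by (auto simp: apply_times intro!: apply_swap_same)
  moreover have "(\<langle>a \<leftrightarrow> c\<rangle> * p) \<langle>$\<rangle> b \<notin> S" if "b \<in> insert a B" for b
  proof (cases "b = a")
    case True
    then show ?thesis using p(1) c insert.hyps by (simp add: apply_times)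
  next
    case False
    then have "b \<in> B" using that by simp
    then have "p \<langle>$\<rangle> b \<notin> insert a S" "p \<langle>$\<rangle> b \<noteq> c"
      using p(2) c by auto
    then show ?thesis by (simp add: apply_times)
  qed
  ultimately show ?case by blast
qed

lemma fresh_star_eqvt: "apply p ` B \<sharp>* p \<bullet> x \<longleftrightarrow> B \<sharp>* x"
  by (simp add: fresh_star_def supp_eqvt)

text \<open>The finitely many members have a common finite bound on their supports. This admits the
  binary conjunction of \<open>A\<close> and \<open>Pred \<phi>\<close>.\<close>

lemma conjunct_set_finite:
  fixes X :: "('p::fs, 'a::bn, 'k) formula set"
  assumes "infinite (UNIV :: 'k set)" "finite X"
  shows "conjunct_set X"
proof (rule conjunct_setI_bounded_supp[where S = "\<Union>A\<in>X. supp A"])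
  show "|X| <o |UNIV :: 'k set|"
    using assms by (intro finite_ordLess_infinite card_of_Well_order) (simp_all add: Field_card_of)
qed (use assms in \<open>auto simp: finite_supp\<close>)

context nominal_transition_system
begin

declare satisfies.simps(4) [simp del]

section \<open>Weak transitions and weak bisimilarity\<close>

lemma bn_tau: "bn tau = {}"
  using bn_subset_supp[of tau] by (simp add: supp_tau)

lemma permute_eq_tau_iff: "p \<bullet> \<alpha> = tau \<longleftrightarrow> \<alpha> = tau"
  by (metis permute_eq_iff tau_eqvt)

lemma weak_tau_step_trans: "P \<Rightarrow>\<^sub>\<tau> Q \<Longrightarrow> Q \<Rightarrow>\<^sub>\<tau> R \<Longrightarrow> P \<Rightarrow>\<^sub>\<tau> R"
  by (induction rule: weak_tau_step.induct) (auto intro: weak_tau_step.intros)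

lemma weak_tau_step_eqvt: "P \<Rightarrow>\<^sub>\<tau> Q \<Longrightarrow> p \<bullet> P \<Rightarrow>\<^sub>\<tau> p \<bullet> Q"
proof (induction rule: weak_tau_step.induct)
  case (2 P P'' P')
  then have "step (p \<bullet> P) tau (p \<bullet> P'')"
    using step_eqvt[of P tau P'' p] by (simp add: tau_eqvt)
  with 2 show ?case by (blast intro: weak_tau_step.intros)
qed (rule weak_tau_step.intros)

lemma weak_step_hat_eqvt: "weak_step_hat P \<alpha> Q \<Longrightarrow> weak_step_hat (p \<bullet> P) (p \<bullet> \<alpha>) (p \<bullet> Q)"
  unfolding weak_step_hat_def weak_step_def permute_eq_tau_iff
  by (simp split: if_splits) (blast intro: weak_tau_step_eqvt step_eqvt)+

lemma weakly_bisimilar_sym: "weakly_bisimilar P Q \<Longrightarrow> weakly_bisimilar Q P"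
  unfolding weakly_bisimilar_def weak_bisimulation_def by (blast dest: sympD)

text \<open>Weak bisimilarity inherits the transfer property from any witnessing bisimulation, which
  also relates the resulting states.\<close>

lemma weakly_bisimilar_step:
  assumes "weakly_bisimilar P Q" "bn \<alpha> \<sharp>* Q" "step P \<alpha> P'"
  obtains Q' where "weak_step_hat Q \<alpha> Q'" "weakly_bisimilar P' Q'"
proof -
  obtain R where "weak_bisimulation R" "R P Q"
    using assms(1) unfolding weakly_bisimilar_def by blast
  then show thesis
    using that assms(2,3) unfolding weakly_bisimilar_def weak_bisimulation_def weak_simulation_def
    by blast
qed

lemma weakly_bisimilar_static:
  assumes "weakly_bisimilar P Q" "P \<turnstile> \<phi>"
  obtains Q' where "Q \<Rightarrow>\<^sub>\<tau> Q'" "Q' \<turnstile> \<phi>" "weakly_bisimilar P Q'"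
proof -
  obtain R where "weak_bisimulation R" "R P Q"
    using assms(1) unfolding weakly_bisimilar_def by blast
  then show thesis
    using that assms(2) unfolding weakly_bisimilar_def weak_bisimulation_def weak_static_implication_def
    by blast
qed

text \<open>Each single silent step is matched by a sequence of silent steps, and these sequences
  compose. The freshness condition is vacuous because \<open>tau\<close> binds no names.\<close>

lemma weakly_bisimilar_weak_tau_step:
  assumes "P \<Rightarrow>\<^sub>\<tau> P'" "weakly_bisimilar P Q"
  shows "\<exists>Q'. Q \<Rightarrow>\<^sub>\<tau> Q' \<and> weakly_bisimilar P' Q'"
  using assms
proof (induction arbitrary: Q rule: weak_tau_step.induct)
  case (1 P)
  then show ?case by (blast intro: weak_tau_step.intros)
next
  case (2 P P'' P')
  have "bn tau \<sharp>* Q"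
    by (simp add: bn_tau fresh_star_def)
  with 2 obtain Q'' where "weak_step_hat Q tau Q''" "weakly_bisimilar P'' Q''"
    by (blast elim: weakly_bisimilar_step)
  with 2 show ?case
    using weak_tau_step_trans unfolding weak_step_hat_def by (metis (full_types))
qed

lemma weakly_bisimilar_eqvt:
  assumes "weakly_bisimilar P Q"
  shows "weakly_bisimilar (p \<bullet> P) (p \<bullet> Q)"
proof -
  \<comment> \<open>\<open>R\<close> is the image of weak bisimilarity under \<open>p\<close>. Its
    transfer properties follow by pulling a challenge back along \<open>inverse p\<close>, answering
    it there and pushing the answer forward along \<open>p\<close>.\<close>
  define R where "R P Q \<longleftrightarrow> weakly_bisimilar (inverse p \<bullet> P) (inverse p \<bullet> Q)" for P Q
  have "symp R"
    by (auto simp: R_def intro!: sympI weakly_bisimilar_sym)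
  moreover have "weak_simulation R"
    unfolding weak_simulation_def
  proof (intro allI impI)
    fix P Q \<alpha> P' assume *: "R P Q" "bn \<alpha> \<sharp>* Q" "step P \<alpha> P'"
    have "bn (inverse p \<bullet> \<alpha>) \<sharp>* inverse p \<bullet> Q"
      using *(2) by (simp add: bn_eqvt fresh_star_eqvt)
    then obtain Q' where Q': "weak_step_hat (inverse p \<bullet> Q) (inverse p \<bullet> \<alpha>) Q'"
      "weakly_bisimilar (inverse p \<bullet> P') Q'"
      using weakly_bisimilar_step *(1) step_eqvt[OF *(3)] unfolding R_def by blast
    show "\<exists>Q'. weak_step_hat Q \<alpha> Q' \<and> R P' Q'"
      using weak_step_hat_eqvt[OF Q'(1), of p] Q'(2) by (intro exI[of _ "p \<bullet> Q'"]) (simp add: R_def)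
  qed
  moreover have "weak_static_implication R"
    unfolding weak_static_implication_def
  proof (intro allI impI)
    fix P Q \<phi> assume *: "R P Q" "P \<turnstile> \<phi>"
    obtain Q' where Q': "inverse p \<bullet> Q \<Rightarrow>\<^sub>\<tau> Q'" "Q' \<turnstile> inverse p \<bullet> \<phi>"
      "weakly_bisimilar (inverse p \<bullet> P) Q'"
      using weakly_bisimilar_static *(1) entails_eqvt[OF *(2)] unfolding R_def by blast
    show "\<exists>Q'. Q \<Rightarrow>\<^sub>\<tau> Q' \<and> Q' \<turnstile> \<phi> \<and> R P Q'"
      using weak_tau_step_eqvt[OF Q'(1), of p] entails_eqvt[OF Q'(2), of p] Q'(3)
      by (intro exI[of _ "p \<bullet> Q'"]) (simp add: R_def)
  qed
  ultimately have "weak_bisimulation R"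
    by (simp add: weak_bisimulation_def)
  moreover have "R (p \<bullet> P) (p \<bullet> Q)"
    using assms by (simp add: R_def)
  ultimately show ?thesis
    unfolding weakly_bisimilar_def by blast
qed

section \<open>Equivariance of satisfaction and semantics of the modalities\<close>

lemma satisfies_eqvt: "p \<bullet> P \<Turnstile> p \<bullet> A \<longleftrightarrow> P \<Turnstile> A"
proof (induction A arbitrary: P p rule: wfp_induct_rule[OF wfP_immediate_subformula])
  case (1 A)
  note IH = 1
  show ?case
  proof (cases A rule: formula_exhaust)
    case (Conj X)
    have "p \<bullet> P \<Turnstile> p \<bullet> B \<longleftrightarrow> P \<Turnstile> B" if "B \<in> X" for B
      using that Conj by (intro IH) (simp add: immediate_subformula.intros)
    then show ?thesis
      using Conj conjunct_set_eqvt[OF Conj(1), of p]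
      by (simp add: Conj_eqvt) (simp add: permute_set_def)
  next
    case (Neg B)
    then show ?thesis
      using IH[of B p P] by (simp add: Neg_eqvt immediate_subformula.intros)
  next
    case (Pred \<phi>)
    then show ?thesis
      using entails_eqvt[of P \<phi> p] entails_eqvt[of "p \<bullet> P" "p \<bullet> \<phi>" "inverse p"]
      by (auto simp: Pred_eqvt)
  next
    case (Act \<alpha> B)
    \<comment> \<open>Allowing an arbitrary \<open>r\<close> makes both directions instances of one
      implication: \<open>r = 1\<close>, \<open>q = p\<close> and \<open>r = p\<close>,
      \<open>q = inverse p\<close>.\<close>
    have fwd: "q \<bullet> r \<bullet> P \<Turnstile> q \<bullet> r \<bullet> A" if "r \<bullet> P \<Turnstile> r \<bullet> A" for q r
    proof -
      from that Act obtain \<alpha>' B' P' where *: "r \<bullet> A = Act \<alpha>' B'" "bn \<alpha>' \<sharp>* r \<bullet> P"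
        "step (r \<bullet> P) \<alpha>' P'" "P' \<Turnstile> B'"
        unfolding Act_eqvt Act(1) satisfies.simps by blast
      have "A = Act (inverse r \<bullet> \<alpha>') (inverse r \<bullet> B')"
        using arg_cong[OF *(1), of "permute (inverse r)"] by (simp add: Act_eqvt)
      \<comment> \<open>The induction hypothesis covers subformulas of \<open>A\<close>, not of
        \<open>r \<bullet> A\<close>, so the body is pulled back along \<open>r\<close>. Formulas
        being alpha-classes, the body of every alpha-variant of \<open>A\<close> counts as an
        immediate subformula.\<close>
      then have sub: "immediate_subformula (inverse r \<bullet> B') A"
        by (simp add: immediate_subformula.intros)
      have "(q * r) \<bullet> inverse r \<bullet> P' \<Turnstile> (q * r) \<bullet> inverse r \<bullet> B'"
        using IH[OF sub, of "q * r" "inverse r \<bullet> P'"] IH[OF sub, of r "inverse r \<bullet> P'"] *(4) by simp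
      then have "q \<bullet> P' \<Turnstile> q \<bullet> B'"
        by (simp add: permute_times)
      moreover have "bn (q \<bullet> \<alpha>') \<sharp>* q \<bullet> r \<bullet> P"
        using *(2) by (simp add: bn_eqvt fresh_star_eqvt)
      moreover have "step (q \<bullet> r \<bullet> P) (q \<bullet> \<alpha>') (q \<bullet> P')"
        using *(3) by (rule step_eqvt)
      ultimately show ?thesis
        unfolding *(1) Act_eqvt satisfies.simps by blast
    qed
    show ?thesis
      using fwd[of 1 p] fwd[of p "inverse p"] by auto
  qed
qed

text \<open>One permutation renames the binding names in the transition and in the formula at once.
  It fixes the remaining names of \<alpha>, \<open>P'\<close> and \<open>A\<close>, so both results
  are alpha-variants, and equivariance preserves satisfaction in the target.\<close>

lemma step_satisfies_rename:
  assumes "step P \<alpha> P'" "P' \<Turnstile> A" "finite S"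
  obtains \<beta> B Q where "Act \<alpha> A = Act \<beta> B" "bn \<beta> \<inter> S = {}" "step P \<beta> Q" "Q \<Turnstile> B"
proof -
  have "finite (S \<union> supp \<alpha> \<union> supp P' \<union> supp A)"
    using assms(3) by (simp add: finite_supp)
  from ex_perm_fresh[OF finite_bn[of \<alpha>] this] obtain p
    where p: "\<forall>a\<in>S \<union> supp \<alpha> \<union> supp P' \<union> supp A - bn \<alpha>. p \<langle>$\<rangle> a = a"
      "apply p ` bn \<alpha> \<inter> (S \<union> supp \<alpha> \<union> supp P' \<union> supp A) = {}"
    by blast
  show thesis
  proof (rule that)
    show "Act \<alpha> A = Act (p \<bullet> \<alpha>) (p \<bullet> A)"
      unfolding Act_eq_iff using p(1) by blast
    show "bn (p \<bullet> \<alpha>) \<inter> S = {}"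
      using p(2) by (auto simp: bn_eqvt)
    show "step P (p \<bullet> \<alpha>) (p \<bullet> P')"
      using p(1) by (intro step_alpha[OF assms(1)]) blast
    show "p \<bullet> P' \<Turnstile> p \<bullet> A"
      using assms(2) by (simp add: satisfies_eqvt)
  qed
qed

text \<open>Binding names of \<alpha> that occur in \<open>P\<close> are first renamed away from
  \<open>supp P\<close>, as the satisfaction clause demands.\<close>

lemma satisfies_ActI:
  assumes "step P \<alpha> P'" "P' \<Turnstile> A"
  shows "P \<Turnstile> Act \<alpha> A"
proof -
  obtain \<beta> B Q where "Act \<alpha> A = Act \<beta> B" "bn \<beta> \<inter> supp P = {}" "step P \<beta> Q" "Q \<Turnstile> B"
    by (rule step_satisfies_rename[OF assms finite_supp])
  then show ?thesis
    unfolding satisfies.simps fresh_star_def by blast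
qed

text \<open>The satisfaction clause gives freshness for \<open>P\<close> only; a further renaming
  avoids any finite set, such as the support of a simulating state.\<close>

lemma satisfies_Act_freshE:
  assumes "P \<Turnstile> Act \<alpha> A" "finite S"
  obtains \<beta> B P' where "Act \<alpha> A = Act \<beta> B" "bn \<beta> \<inter> S = {}" "step P \<beta> P'" "P' \<Turnstile> B"
proof -
  from assms(1) obtain \<alpha>' A' P' where *: "Act \<alpha> A = Act \<alpha>' A'" "step P \<alpha>' P'" "P' \<Turnstile> A'"
    unfolding satisfies.simps by blast
  show thesis
    using step_satisfies_rename[OF *(2,3) assms(2)] that *(1) by metis
qed

text \<open>Since \<open>tau\<close> binds nothing, a permutation witnessing an alpha-variant fixes
  \<open>supp A\<close> and hence \<open>A\<close> itself.\<close>

lemma satisfies_Act_tau: "P \<Turnstile> Act tau A \<longleftrightarrow> (\<exists>P'. step P tau P' \<and> P' \<Turnstile> A)"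
proof
  assume "P \<Turnstile> Act tau A"
  then obtain \<alpha>' A' P' where *: "Act tau A = Act \<alpha>' A'" "step P \<alpha>' P'" "P' \<Turnstile> A'"
    unfolding satisfies.simps by blast
  then obtain p where p: "p \<bullet> tau = \<alpha>'" "p \<bullet> A = A'" "\<forall>a \<in> (supp tau \<union> supp A) - bn tau. p \<langle>$\<rangle> a = a"
    by (auto simp: Act_eq_iff)
  then have "A' = A"
    using supp_supports[of A p] by (simp add: bn_tau)
  with * p(1) show "\<exists>P'. step P tau P' \<and> P' \<Turnstile> A"
    by (auto simp: tau_eqvt)
qed (auto intro: satisfies_ActI)

lemma satisfies_Disj:
  "conjunct_set (Neg ` X) \<Longrightarrow> P \<Turnstile> Disj X \<longleftrightarrow> (\<exists>A\<in>X. P \<Turnstile> A)"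
  by (simp add: Disj_def)

text \<open>The exponent \<open>i\<close> of a satisfied disjunct is the number of silent steps from
  \<open>P\<close> to \<open>P'\<close>. The bound on \<kappa> makes the countable disjunction a
  formula.\<close>

lemma satisfies_weak_diamond_tau:
  fixes A :: "('p, 'a, 'k) formula"
  assumes "natLeq <o |UNIV :: 'k set|"
  shows "P \<Turnstile> weak_diamond_tau A \<longleftrightarrow> (\<exists>P'. P \<Rightarrow>\<^sub>\<tau> P' \<and> P' \<Turnstile> A)"
proof -
  have "P \<Turnstile> weak_diamond_tau A \<longleftrightarrow> (\<exists>i. P \<Turnstile> (Act tau ^^ i) A)"
    unfolding weak_diamond_tau_def
    using satisfies_Disj[OF conjunct_set_weak_diamond_tau[OF assms]] by auto
  also have "\<dots> \<longleftrightarrow> (\<exists>P'. P \<Rightarrow>\<^sub>\<tau> P' \<and> P' \<Turnstile> A)"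
  proof
    assume "\<exists>i. P \<Turnstile> (Act tau ^^ i) A"
    then obtain i where "P \<Turnstile> (Act tau ^^ i) A" ..
    then show "\<exists>P'. P \<Rightarrow>\<^sub>\<tau> P' \<and> P' \<Turnstile> A"
    proof (induction i arbitrary: P)
      case 0
      then show ?case by (auto intro: weak_tau_step.intros)
    next
      case (Suc i)
      then obtain P'' where "step P tau P''" "P'' \<Turnstile> (Act tau ^^ i) A"
        by (auto simp: satisfies_Act_tau)
      with Suc.IH show ?case by (blast intro: weak_tau_step.intros)
    qed
  next
    assume "\<exists>P'. P \<Rightarrow>\<^sub>\<tau> P' \<and> P' \<Turnstile> A"
    then obtain P' where "P \<Rightarrow>\<^sub>\<tau> P'" "P' \<Turnstile> A" by blast
    then show "\<exists>i. P \<Turnstile> (Act tau ^^ i) A"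
    proof (induction rule: weak_tau_step.induct)
      case (1 P)
      then show ?case by (intro exI[of _ 0]) simp
    next
      case (2 P P'' P')
      then obtain i where "P'' \<Turnstile> (Act tau ^^ i) A" by blast
      with 2(1) have "P \<Turnstile> (Act tau ^^ Suc i) A"
        by (auto simp: satisfies_Act_tau)
      then show ?case ..
    qed
  qed
  finally show ?thesis .
qed

lemma weak_diamond_tau_eqvt:
  fixes A :: "('p, 'a, 'k) formula"
  assumes "natLeq <o |UNIV :: 'k set|"
  shows "p \<bullet> weak_diamond_tau A = weak_diamond_tau (p \<bullet> A)"
proof -
  have "p \<bullet> Neg ` range (\<lambda>i::nat. (Act tau ^^ i) A) = Neg ` range (\<lambda>i::nat. (Act tau ^^ i) (p \<bullet> A))"
    by (simp add: permute_set_def image_image Neg_eqvt Act_tau_power_eqvt)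
  then show ?thesis
    by (simp add: weak_diamond_tau_def Disj_def Neg_eqvt Conj_eqvt[OF conjunct_set_weak_diamond_tau[OF assms]])
qed

section \<open>Preservation of weak formulas under weak bisimilarity\<close>

text \<open>One implication suffices: symmetry of weak bisimilarity gives the converse, and it also
  settles negation.\<close>

lemma weakly_bisimilar_satisfies:
  fixes A :: "('p, 'a, 'k) formula"
  assumes \<kappa>: "natLeq <o |UNIV :: 'k set|"
    and "weak_formula A" "weakly_bisimilar P Q" "P \<Turnstile> A"
  shows "Q \<Turnstile> A"
  using assms(2-)
proof (induction A arbitrary: P Q rule: weak_formula.induct)
  case (1 X)
  then show ?case by auto
next
  case (2 A)
  then show ?case using weakly_bisimilar_sym by auto
next
  case (3 A \<alpha>)
  show ?case
  proof (cases "\<alpha> = tau")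
    case True
    with 3 obtain P' where P': "P \<Rightarrow>\<^sub>\<tau> P'" "P' \<Turnstile> A"
      by (auto simp: weak_diamond_def satisfies_weak_diamond_tau[OF \<kappa>])
    obtain Q' where "Q \<Rightarrow>\<^sub>\<tau> Q'" "weakly_bisimilar P' Q'"
      using weakly_bisimilar_weak_tau_step[OF P'(1) 3(3)] by blast
    with True P' 3 show ?thesis
      by (auto simp: weak_diamond_def satisfies_weak_diamond_tau[OF \<kappa>])
  next
    case False
    with 3 obtain P\<^sub>1 where P1: "P \<Rightarrow>\<^sub>\<tau> P\<^sub>1" "P\<^sub>1 \<Turnstile> Act \<alpha> (weak_diamond_tau A)"
      by (auto simp: weak_diamond_def satisfies_weak_diamond_tau[OF \<kappa>])
    obtain Q\<^sub>1 where Q1: "Q \<Rightarrow>\<^sub>\<tau> Q\<^sub>1" "weakly_bisimilar P\<^sub>1 Q\<^sub>1"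
      using weakly_bisimilar_weak_tau_step[OF P1(1) 3(3)] by blast
    \<comment> \<open>The variant is chosen fresh for \<open>Q\<^sub>1\<close>, the state that has
      to simulate the \<beta>-transition.\<close>
    obtain \<beta> B P\<^sub>2 where B: "Act \<alpha> (weak_diamond_tau A) = Act \<beta> B" "bn \<beta> \<inter> supp Q\<^sub>1 = {}"
      "step P\<^sub>1 \<beta> P\<^sub>2" "P\<^sub>2 \<Turnstile> B"
      by (rule satisfies_Act_freshE[OF P1(2) finite_supp])
    obtain p where p: "\<beta> = p \<bullet> \<alpha>" "B = weak_diamond_tau (p \<bullet> A)"
      using B(1) by (auto simp: Act_eq_iff weak_diamond_tau_eqvt[OF \<kappa>])
    have "\<beta> \<noteq> tau"
      using False by (simp add: p permute_eq_tau_iff)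
    have "bn \<beta> \<sharp>* Q\<^sub>1"
      using B(2) by (auto simp: fresh_star_def)
    then obtain Q\<^sub>2 where "weak_step_hat Q\<^sub>1 \<beta> Q\<^sub>2" and P2Q2: "weakly_bisimilar P\<^sub>2 Q\<^sub>2"
      using weakly_bisimilar_step[OF Q1(2) _ B(3)] by blast
    then obtain Q' Q'' where Q': "Q\<^sub>1 \<Rightarrow>\<^sub>\<tau> Q'" "step Q' \<beta> Q''" "Q'' \<Rightarrow>\<^sub>\<tau> Q\<^sub>2"
      using \<open>\<beta> \<noteq> tau\<close> by (auto simp: weak_step_hat_def weak_step_def)
    obtain P\<^sub>3 where P3: "P\<^sub>2 \<Rightarrow>\<^sub>\<tau> P\<^sub>3" "P\<^sub>3 \<Turnstile> p \<bullet> A"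
      using B(4) by (auto simp: p satisfies_weak_diamond_tau[OF \<kappa>])
    obtain Q\<^sub>3 where Q3: "Q\<^sub>2 \<Rightarrow>\<^sub>\<tau> Q\<^sub>3" "weakly_bisimilar P\<^sub>3 Q\<^sub>3"
      using weakly_bisimilar_weak_tau_step[OF P3(1) P2Q2] by blast
    \<comment> \<open>The induction hypothesis speaks of \<open>A\<close>, but the renamed body
      contains \<open>p \<bullet> A\<close>. Both states are therefore moved along
      \<open>inverse p\<close>, and the conclusion is moved back along \<open>p\<close>.\<close>
    have "inverse p \<bullet> P\<^sub>3 \<Turnstile> A"
      using P3(2) satisfies_eqvt[of "inverse p" P\<^sub>3 "p \<bullet> A"] by simp
    then have "inverse p \<bullet> Q\<^sub>3 \<Turnstile> A"
      by (rule 3(2)[OF weakly_bisimilar_eqvt[OF Q3(2)]])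
    then have "Q\<^sub>3 \<Turnstile> p \<bullet> A"
      using satisfies_eqvt[of p "inverse p \<bullet> Q\<^sub>3" A] by simp
    then have "Q'' \<Turnstile> B"
      using weak_tau_step_trans[OF Q'(3) Q3(1)] by (auto simp: p satisfies_weak_diamond_tau[OF \<kappa>])
    \<comment> \<open>Silent steps may have led to a \<open>Q'\<close> in which names of
      \<open>bn \<beta>\<close> occur; \<open>satisfies_ActI\<close> renames them once more.\<close>
    then have "Q' \<Turnstile> Act \<alpha> (weak_diamond_tau A)"
      unfolding B(1) by (rule satisfies_ActI[OF Q'(2)])
    then show ?thesis
      using False weak_tau_step_trans[OF Q1(1) Q'(1)]
      by (auto simp: weak_diamond_def satisfies_weak_diamond_tau[OF \<kappa>])
  qed
next
  case (4 A \<phi>)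
  have "infinite (UNIV :: 'k set)"
    using \<kappa> by (meson infinite_iff_natLeq_ordLeq ordLess_imp_ordLeq)
  then have "conjunct_set {A, Pred \<phi>}"
    by (rule conjunct_set_finite) simp
  then have sat: "R \<Turnstile> weak_diamond tau (Conj {A, Pred \<phi>}) \<longleftrightarrow> (\<exists>R'. R \<Rightarrow>\<^sub>\<tau> R' \<and> R' \<Turnstile> A \<and> R' \<turnstile> \<phi>)" for R
    by (simp add: weak_diamond_def satisfies_weak_diamond_tau[OF \<kappa>])
  with 4 obtain P' where P': "P \<Rightarrow>\<^sub>\<tau> P'" "P' \<Turnstile> A" "P' \<turnstile> \<phi>"
    by auto
  obtain Q\<^sub>1 where Q1: "Q \<Rightarrow>\<^sub>\<tau> Q\<^sub>1" "weakly_bisimilar P' Q\<^sub>1"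
    using weakly_bisimilar_weak_tau_step[OF P'(1) 4(3)] by blast
  \<comment> \<open>Static implication yields a state that satisfies \<phi> and is still bisimilar
    to \<open>P'\<close>, so \<open>A\<close> and \<phi> hold together at
    \<open>Q\<^sub>2\<close>.\<close>
  obtain Q\<^sub>2 where "Q\<^sub>1 \<Rightarrow>\<^sub>\<tau> Q\<^sub>2" "Q\<^sub>2 \<turnstile> \<phi>" "weakly_bisimilar P' Q\<^sub>2"
    by (rule weakly_bisimilar_static[OF Q1(2) P'(3)])
  with 4(2) P'(2) Q1(1) show ?case
    unfolding sat using weak_tau_step_trans by blast
qed

end

theorem theorem7p15:
  fixes entails :: "'s::fs \<Rightarrow> 'p::fs \<Rightarrow> bool"
    and step :: "'s \<Rightarrow> 'a::bn \<Rightarrow> 's \<Rightarrow> bool"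
    and tau :: 'a
    and P Q :: 's
  assumes "nominal_transition_system entails step tau"
    and "natLeq <o |UNIV :: 'k set|"
    and "|UNIV :: 's set| <o |UNIV :: 'k set|"
    and "nominal_transition_system.weakly_bisimilar entails step tau P Q"
  shows "nominal_transition_system.weakly_logically_equivalent entails step tau TYPE('k) P Q"
proof -
  interpret nominal_transition_system entails step tau
    by (rule assms(1))
  show ?thesis
    unfolding weakly_logically_equivalent_def
    using weakly_bisimilar_satisfies[OF assms(2)] assms(4) weakly_bisimilar_sym by blast
qed

end
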